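(* Let $(X,\|\cdot\|_X)$ and $(Y,\|\cdot\|_Y)$ be real Banach spaces with $X$ uniformly convex and compactly embedded into $Y$, let $p>1$ and $q>1$ be real numbers, and let $A:X\to X^\star$ and $B:Y\to Y^\star$ be continuous maps satisfying hypotheses (A1), (A2), (B1), (B2), (AB) listed in the context. Let $\mu:=\inf\{\|w\|_X^p : w\in X,\ \|w\|_Y=1\}$. Let $w_0\in Y$ with $\|w_0\|_Y=1$, and let $\{w_n\}_{n\ge 0}$, $\{\lambda_n\}_{n\ge 0}$ be any inverse iteration sequences starting from $w_0$ (as defined in the context), so that $w_{n}\in X$ and $\|w_n\|_Y=1$ for $n\ge 1$, and $$\langle A(w_{n+1}),v\rangle=\lambda_n\langle B(w_n),v\rangle\qquad\text{for all } v\in X \text{ and all } n\ge 0 .$$ Then the sequences $\{\lambda_n\}$ and $\{\|w_{n+1}\|_X^p\}$ are nonincreasing and converge to the same limit $\lambda$, and $\lambda\ge\mu$. Moreover, $\lambda$ is an eigenvalue of $$A(w)=\lambda\|w\|_Y^{p-q}B(w),$$ and there exist a strictly increasing sequence of indices $\{n_j\}_{j\in\mathbb{N}}$ and a vector $w\in X$ with $\|w\|_Y=1$ such that both $\{w_{n_j}\}_{j}$ and $\{w_{n_j+1}\}_{j}$ converge to $w$ in the norm of $X$, and $w$ is an eigenvector corresponding to $\lambda$.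
   Context: $X^\star,Y^\star$ are the topological dual spaces, and $\langle f,v\rangle:=f(v)$. "Compactly embedded" means that $X$ is a linear subspace of $Y$ and the inclusion $X\hookrightarrow Y$ is a compact linear operator (in particular continuous). Hypotheses: (A1) $A(tw)=|t|^{p-2}t\,A(w)$ for all $t\in\mathbb{R}$, $w\in X$. (A2) $\langle A(u),v\rangle\le\|u\|_X^{p-1}\|v\|_X$ for all $u,v\in X$, with equality if and only if either $u=0$ or $v=0$ or $u=tv$ for some $t>0$. (B1) $B(tw)=|t|^{q-2}t\,B(w)$ for all $t\in\mathbb{R}$, $w\in Y$. (B2) $\langle B(u),v\rangle\le\|u\|_Y^{q-1}\|v\|_Y$ for all $u,v\in Y$, with equality whenever $u=tv$ for some $t\ge 0$. (AB) For each $w\in Y\setminus\{0\}$ there exists at least one $u\in X\setminus\{0\}$ such that $\langle A(u),v\rangle=\langle B(w),v\rangle$ for all $v\in X$. (Here $|t|^{p-2}t$ and $|t|^{q-2}t$ are $0$ at $t=0$.) Eigenpairs: $\lambda\in\mathbb{R}$ is an eigenvalue of $A(w)=\lambda\|w\|_Y^{p-q}B(w)$, with corresponding eigenvector $w\in X\setminus\{0\}$, if $\langle A(w),v\rangle=\lambda\|w\|_Y^{p-q}\langle B(w),v\rangle$ for all $v\in X$. Inverse iteration sequence: given $w_0\in Y$ with $\|w_0\|_Y=1$, for each $n\ge0$ one uses (AB) to choose some $u_{n+1}\in X\setminus\{0\}$ with $\langle A(u_{n+1}),v\rangle=\langle B(w_n),v\rangle$ for all $v\in X$, and sets $w_{n+1}:=\|u_{n+1}\|_Y^{-1}u_{n+1}$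 and $\lambda_n:=\|u_{n+1}\|_Y^{1-p}$. *)

theory Defs
  imports "HOL-Analysis.Analysis"
begin

definition uniformly_convex :: "'a::real_normed_vector itself \<Rightarrow> bool" where
  "uniformly_convex (_ :: 'a itself) \<longleftrightarrow>
     (\<forall>\<epsilon>>0. \<exists>\<delta>>0. \<forall>x y :: 'a. norm x = 1 \<and> norm y = 1 \<and> norm (x - y) \<ge> \<epsilon>
        \<longrightarrow> norm ((1 / 2) *\<^sub>R (x + y)) \<le> 1 - \<delta>)"

definition compact_operator :: "('a::real_normed_vector \<Rightarrow> 'b::real_normed_vector) \<Rightarrow> bool" where
  "compact_operator T \<longleftrightarrow> bounded_linear T \<and> (\<forall>S. bounded S \<longrightarrow> compact (closure (T ` S)))"

(* The spaces X and Y are two Banach space types, each with its own norm. The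
   inclusion of X into Y is an injective linear map \<iota>, through which an
   element x of X is regarded as the element \<iota> x of Y; thus norm x is the
   X-norm of x, and norm (\<iota> x) is its Y-norm. *)
definition compact_embedding :: "('x::real_normed_vector \<Rightarrow> 'y::real_normed_vector) \<Rightarrow> bool" where
  "compact_embedding \<iota> \<longleftrightarrow> compact_operator \<iota> \<and> inj \<iota>"

definition eigenpair ::
  "('x::real_normed_vector \<Rightarrow> 'y::real_normed_vector) \<Rightarrow> real \<Rightarrow> real \<Rightarrow>
   ('x \<Rightarrow> ('x \<Rightarrow>\<^sub>L real)) \<Rightarrow> ('y \<Rightarrow> ('y \<Rightarrow>\<^sub>L real)) \<Rightarrow> real \<Rightarrow> 'x \<Rightarrow> bool" where
  "eigenpair \<iota> p q A B l w \<longleftrightarrow> w \<noteq> 0 \<and>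
     (\<forall>v. A w v = l * norm (\<iota> w) powr (p - q) * B (\<iota> w) (\<iota> v))"

definition eigenvalue ::
  "('x::real_normed_vector \<Rightarrow> 'y::real_normed_vector) \<Rightarrow> real \<Rightarrow> real \<Rightarrow>
   ('x \<Rightarrow> ('x \<Rightarrow>\<^sub>L real)) \<Rightarrow> ('y \<Rightarrow> ('y \<Rightarrow>\<^sub>L real)) \<Rightarrow> real \<Rightarrow> bool" where
  "eigenvalue \<iota> p q A B l \<longleftrightarrow> (\<exists>w. eigenpair \<iota> p q A B l w)"

(* The iterate w n lies in Y and, for n \<ge> 1, also in X; its representative
   in X is x n. The values u 0 and x 0 are unconstrained and carry no meaning,
   since the starting point w0 need not lie in X. *)
definition inverse_iteration ::
  "('x::real_normed_vector \<Rightarrow> 'y::real_normed_vector) \<Rightarrow> real \<Rightarrow>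
   ('x \<Rightarrow> ('x \<Rightarrow>\<^sub>L real)) \<Rightarrow> ('y \<Rightarrow> ('y \<Rightarrow>\<^sub>L real)) \<Rightarrow> 'y \<Rightarrow>
   (nat \<Rightarrow> 'x) \<Rightarrow> (nat \<Rightarrow> 'x) \<Rightarrow> (nat \<Rightarrow> 'y) \<Rightarrow> (nat \<Rightarrow> real) \<Rightarrow> bool" where
  "inverse_iteration \<iota> p A B w0 u x w l \<longleftrightarrow> w 0 = w0 \<and>
     (\<forall>n. u (Suc n) \<noteq> 0 \<and>
          (\<forall>v. A (u (Suc n)) v = B (w n) (\<iota> v)) \<and>
          x (Suc n) = inverse (norm (\<iota> (u (Suc n)))) *\<^sub>R u (Suc n) \<and>
          w (Suc n) = \<iota> (x (Suc n)) \<and>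
          l n = norm (\<iota> (u (Suc n))) powr (1 - p))"

end

theory Submission
  imports Defs
begin

text \<open>
  Testing the iteration equation with \<open>x (n + 1)\<close> and with \<open>x n\<close> gives
  \<open>\<parallel>x (n + 1)\<parallel>\<^sup>p \<le> l n \<le> \<parallel>x (n + 1)\<parallel>\<^sup>p\<^sup>-\<^sup>1 \<parallel>x n\<parallel>\<close>, so the two sequences interlace and
  decrease to a common limit \<open>L = a\<^sup>p > 0\<close>. Along a subsequence \<open>w n\<close> converges in \<open>Y\<close> to
  some \<open>y\<close>, hence \<open>A (x (n + 1))\<close> converges in the norm of the dual of \<open>X\<close> to \<open>L B(y)\<close>, which by
  (AB) is \<open>A z\<close> for some \<open>z\<close>. No weak compactness is needed: uniform convexity implies that
  \<open>s n - t n \<rightarrow> 0\<close> whenever \<open>\<parallel>s n\<parallel>\<close> and \<open>\<parallel>t n\<parallel>\<close> tend to \<open>a\<close> and \<open>\<langle>A (s n), t n\<rangle> \<rightarrow> a\<^sup>p\<close>. This applies to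
  \<open>x (n + 1)\<close> against the constant \<open>z\<close>, and to \<open>x (n + 1)\<close> against \<open>x n\<close>.
\<close>

text \<open>Sequential form of uniform convexity: a distance of at least \<open>e\<close> would keep
  the midpoint at norm at most \<open>1 - d\<close>, which the limit 2 eventually forbids. Unit
  norms are asked only eventually because the lemma is applied to \<open>sgn\<close>, which vanishes
  at 0.\<close>

lemma uniformly_convex_tendsto_unit:
  fixes s t :: "nat \<Rightarrow> 'a::real_normed_vector"
  assumes uc: "uniformly_convex TYPE('a)"
    and unit: "\<forall>\<^sub>F n in sequentially. norm (s n) = 1 \<and> norm (t n) = 1"
    and lim: "(\<lambda>n. norm (s n + t n)) \<longlonglongrightarrow> 2"
  shows "(\<lambda>n. s n - t n) \<longlonglongrightarrow> 0"
proof (rule tendstoI)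
  fix e :: real assume "e > 0"
  with uc obtain d where d: "d > 0" and
    *: "\<And>y z :: 'a. norm y = 1 \<Longrightarrow> norm z = 1 \<Longrightarrow> norm (y - z) \<ge> e
        \<Longrightarrow> norm ((1 / 2) *\<^sub>R (y + z)) \<le> 1 - d"
    unfolding uniformly_convex_def by meson
  have "\<forall>\<^sub>F n in sequentially. norm (s n + t n) > 2 - 2 * d"
    using order_tendstoD(1)[OF lim, of "2 - 2 * d"] d by simp
  with unit show "\<forall>\<^sub>F n in sequentially. dist (s n - t n) 0 < e"
  proof eventually_elim
    case (elim n)
    show ?case
    proof (rule ccontr)
      assume "\<not> dist (s n - t n) 0 < e"
      then have "norm ((1 / 2) *\<^sub>R (s n + t n)) \<le> 1 - d"
        using elim by (intro *) auto
      with elim show False by simp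
    qed
  qed
qed

lemma tendsto_diff_normalized:
  fixes s :: "nat \<Rightarrow> 'a::real_normed_vector"
  assumes lim: "(\<lambda>n. norm (s n)) \<longlonglongrightarrow> a" and "a > 0"
  shows "(\<lambda>n. sgn (s n) - (1 / a) *\<^sub>R s n) \<longlonglongrightarrow> 0"
proof (rule tendsto_norm_zero_cancel)
  have "(\<lambda>n. \<bar>inverse (norm (s n)) - 1 / a\<bar> * norm (s n)) \<longlonglongrightarrow> \<bar>inverse a - 1 / a\<bar> * a"
    using \<open>a > 0\<close> by (intro tendsto_intros lim) auto
  moreover have "norm (sgn (s n) - (1 / a) *\<^sub>R s n) = \<bar>inverse (norm (s n)) - 1 / a\<bar> * norm (s n)" for n
    by (simp add: sgn_div_norm flip: scaleR_diff_left)
  ultimately show "(\<lambda>n. norm (sgn (s n) - (1 / a) *\<^sub>R s n)) \<longlonglongrightarrow> 0"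
    using \<open>a > 0\<close> by (simp add: inverse_eq_divide)
qed

text \<open>Reduction to the unit sphere: since the norms tend to \<open>a\<close>, normalizing is
  asymptotically the same as dividing by \<open>a\<close>, so the normalized sums have norms tending
  to 2.\<close>

lemma uniformly_convex_tendsto:
  fixes s t :: "nat \<Rightarrow> 'a::real_normed_vector"
  assumes uc: "uniformly_convex TYPE('a)"
    and s: "(\<lambda>n. norm (s n)) \<longlonglongrightarrow> a" and t: "(\<lambda>n. norm (t n)) \<longlonglongrightarrow> a" and a: "a > 0"
    and lim: "(\<lambda>n. norm (s n + t n)) \<longlonglongrightarrow> 2 * a"
  shows "(\<lambda>n. s n - t n) \<longlonglongrightarrow> 0"
proof -
  note s' = tendsto_diff_normalized[OF s a] and t' = tendsto_diff_normalized[OF t a]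
  have "(\<lambda>n. sgn (s n) - sgn (t n)) \<longlonglongrightarrow> 0"
  proof (rule uniformly_convex_tendsto_unit[OF uc])
    have "\<forall>\<^sub>F n in sequentially. norm (s n) > 0" "\<forall>\<^sub>F n in sequentially. norm (t n) > 0"
      using s t a by (auto dest: order_tendstoD(1))
    then show "\<forall>\<^sub>F n in sequentially. norm (sgn (s n)) = 1 \<and> norm (sgn (t n)) = 1"
      by eventually_elim (auto simp: norm_sgn)
    let ?d = "\<lambda>n. (sgn (s n) - (1 / a) *\<^sub>R s n) + (sgn (t n) - (1 / a) *\<^sub>R t n)"
    have d: "?d \<longlonglongrightarrow> 0"
      using tendsto_add[OF s' t'] by simp
    have scaled: "(\<lambda>n. norm ((1 / a) *\<^sub>R (s n + t n))) \<longlonglongrightarrow> 2"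
      using tendsto_mult[OF tendsto_const[of "1 / a"] lim] a by simp
    have "(\<lambda>n. norm (sgn (s n) + sgn (t n)) - norm ((1 / a) *\<^sub>R (s n + t n))) \<longlonglongrightarrow> 0"
    proof (rule Lim_null_comparison[OF _ tendsto_norm_zero[OF d]], rule always_eventually, rule allI)
      fix n
      have "sgn (s n) + sgn (t n) - (1 / a) *\<^sub>R (s n + t n) = ?d n"
        by (simp add: algebra_simps)
      then show "norm (norm (sgn (s n) + sgn (t n)) - norm ((1 / a) *\<^sub>R (s n + t n))) \<le> norm (?d n)"
        using norm_triangle_ineq3[of "sgn (s n) + sgn (t n)" "(1 / a) *\<^sub>R (s n + t n)"]
        by (simp only: real_norm_def)
    qed
    from tendsto_add[OF this scaled] show "(\<lambda>n. norm (sgn (s n) + sgn (t n))) \<longlonglongrightarrow> 2"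
      by simp
  qed
  \<comment> \<open>Undo the scaling: \<open>a\<close> times
    \<open>(sgn s - sgn t) - (sgn s - s / a) + (sgn t - t / a)\<close> is
    \<open>s - t\<close>.\<close>
  from tendsto_scaleR[OF tendsto_const[of a] tendsto_add[OF tendsto_diff[OF this s'] t']]
  show ?thesis
    using a by (simp add: algebra_simps)
qed

text \<open>Testing with \<open>v\<close> and \<open>- v\<close> bounds the dual norm from above,
  testing with \<open>y\<close> from below. At \<open>y = 0\<close> the equality \<open>eq\<close>
  reads 0 = 0, hence the separate assumption on \<open>A 0\<close>.\<close>

lemma norm_duality_map:
  fixes A :: "'x::real_normed_vector \<Rightarrow> ('x \<Rightarrow>\<^sub>L real)"
  assumes le: "\<And>y z. A y z \<le> norm y powr r * norm z"
    and eq: "\<And>y. A y y = norm y powr r * norm y"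
    and "A 0 = 0"
  shows "norm (A y) = norm y powr r"
proof (rule antisym)
  show "norm (A y) \<le> norm y powr r"
  proof (rule norm_blinfun_bound)
    fix v
    show "norm (A y v) \<le> norm y powr r * norm v"
      using le[of y v] le[of y "- v"] by (simp add: blinfun.minus_right abs_le_iff)
  qed simp
  show "norm y powr r \<le> norm (A y)"
  proof (cases "y = 0")
    case False
    have "norm y powr r * norm y \<le> norm (A y) * norm y"
      using norm_blinfun[of "A y" y] eq[of y] by simp
    with False show ?thesis by simp
  qed (simp add: \<open>A 0 = 0\<close>)
qed

text \<open>Testing \<open>A (s n)\<close> with \<open>s n + t n\<close> and dividing by
  \<open>norm (s n) powr r\<close> bounds \<open>norm (s n + t n)\<close> below by a quantity
  tending to \<open>2 * a\<close>; the triangle inequality gives the matching upper bound, and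
  uniform convexity concludes.\<close>

lemma duality_map_tendsto:
  fixes A :: "'x::real_normed_vector \<Rightarrow> ('x \<Rightarrow>\<^sub>L real)"
  assumes uc: "uniformly_convex TYPE('x)"
    and le: "\<And>y z. A y z \<le> norm y powr r * norm z"
    and eq: "\<And>y. A y y = norm y powr r * norm y"
    and s: "(\<lambda>n. norm (s n)) \<longlonglongrightarrow> a" and t: "(\<lambda>n. norm (t n)) \<longlonglongrightarrow> a" and a: "a > 0"
    and lim: "(\<lambda>n. A (s n) (t n)) \<longlonglongrightarrow> a powr r * a"
  shows "(\<lambda>n. s n - t n) \<longlonglongrightarrow> 0"
proof (rule uniformly_convex_tendsto[OF uc s t a], rule tendsto_sandwich)
  have sr: "(\<lambda>n. norm (s n) powr r) \<longlonglongrightarrow> a powr r"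
    using a by (intro tendsto_powr s) auto
  show "\<forall>\<^sub>F n in sequentially. norm (s n) + A (s n) (t n) / norm (s n) powr r \<le> norm (s n + t n)"
    using order_tendstoD(1)[OF s a]
  proof eventually_elim
    case (elim n)
    then have "norm (s n) powr r > 0" by simp
    moreover have "norm (s n) powr r * norm (s n) + A (s n) (t n) \<le> norm (s n) powr r * norm (s n + t n)"
      using le[of "s n" "s n + t n"] eq[of "s n"] by (simp add: blinfun.add_right)
    ultimately show ?case by (simp add: field_simps)
  qed
  show "\<forall>\<^sub>F n in sequentially. norm (s n + t n) \<le> norm (s n) + norm (t n)"
    by (simp add: norm_triangle_ineq)
  have "(\<lambda>n. norm (s n) + A (s n) (t n) / norm (s n) powr r) \<longlonglongrightarrow> a + a powr r * a / a powr r"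
    using a by (intro tendsto_intros s sr lim) auto
  with a show "(\<lambda>n. norm (s n) + A (s n) (t n) / norm (s n) powr r) \<longlonglongrightarrow> 2 * a" by simp
  show "(\<lambda>n. norm (s n) + norm (t n)) \<longlonglongrightarrow> 2 * a"
    using tendsto_add[OF s t] by simp
qed

theorem theorem1:
  fixes \<iota> :: "'x::banach \<Rightarrow> 'y::banach"
    and p q \<mu> :: real
    and A :: "'x \<Rightarrow> ('x \<Rightarrow>\<^sub>L real)"
    and B :: "'y \<Rightarrow> ('y \<Rightarrow>\<^sub>L real)"
    and w0 :: 'y
    and u x :: "nat \<Rightarrow> 'x"
    and w :: "nat \<Rightarrow> 'y"
    and l :: "nat \<Rightarrow> real"
  assumes "uniformly_convex TYPE('x)"
    and "compact_embedding \<iota>"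
    and "p > 1" and "q > 1"
    and "continuous_on UNIV A" and "continuous_on UNIV B"
    and A1: "\<forall>t z. A (t *\<^sub>R z) = (\<bar>t\<bar> powr (p - 2) * t) *\<^sub>R A z"
    and A2: "\<forall>y z. A y z \<le> norm y powr (p - 1) * norm z \<and>
               (A y z = norm y powr (p - 1) * norm z \<longleftrightarrow>
                  y = 0 \<or> z = 0 \<or> (\<exists>t>0. y = t *\<^sub>R z))"
    and B1: "\<forall>t z. B (t *\<^sub>R z) = (\<bar>t\<bar> powr (q - 2) * t) *\<^sub>R B z"
    and B2: "\<forall>y z. B y z \<le> norm y powr (q - 1) * norm z \<and>
               ((\<exists>t\<ge>0. y = t *\<^sub>R z) \<longrightarrow> B y z = norm y powr (q - 1) * norm z)"
    and AB: "\<forall>z. z \<noteq> 0 \<longrightarrow> (\<exists>y. y \<noteq> 0 \<and> (\<forall>v. A y v = B z (\<iota> v)))"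
    and \<mu>: "\<mu> = Inf {norm z powr p | z. norm (\<iota> z) = 1}"
    and "norm w0 = 1"
    and "inverse_iteration \<iota> p A B w0 u x w l"
  shows "(\<forall>n\<ge>1. w n = \<iota> (x n) \<and> norm (w n) = 1) \<and>
    (\<forall>n v. A (x (Suc n)) v = l n * B (w n) (\<iota> v)) \<and>
    decseq l \<and> decseq (\<lambda>n. norm (x (Suc n)) powr p) \<and>
    (\<exists>L. l \<longlonglongrightarrow> L \<and> (\<lambda>n. norm (x (Suc n)) powr p) \<longlonglongrightarrow> L \<and> L \<ge> \<mu> \<and>
       eigenvalue \<iota> p q A B L \<and>
       (\<exists>r z. strict_mono r \<and> (\<forall>j. r j \<ge> 1) \<and> norm (\<iota> z) = 1 \<and>
          (\<lambda>j. x (r j)) \<longlonglongrightarrow> z \<and> (\<lambda>j. x (r j + 1)) \<longlonglongrightarrow> z \<and>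
          eigenpair \<iota> p q A B L z))"
proof -
  note uc = assms(1) and p = \<open>p > 1\<close>
  have Ale: "A y z \<le> norm y powr (p - 1) * norm z" for y z using A2 by blast
  have Aeq: "A y y = norm y powr (p - 1) * norm y" for y
    using A2 zero_less_one scaleR_one by metis
  have Ble: "B y z \<le> norm y powr (q - 1) * norm z" for y z using B2 by blast
  have Beq: "B y y = norm y powr (q - 1) * norm y" for y
    using B2 zero_le_one scaleR_one by metis
  have A0: "A 0 = 0" using spec[OF spec[OF A1, of 0], of 0] by simp
  have Ascale: "A (t *\<^sub>R z) = t powr (p - 1) *\<^sub>R A z" if "t > 0" for t z
    using A1 that powr_mult_base[of t "p - 2"] by (simp add: mult.commute)
  have powp: "norm y powr (p - 1) * norm y = norm y powr p" for y :: 'x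
    using powr_mult_base[of "norm y" "p - 1"] by (simp add: mult.commute)

  have bl: "bounded_linear \<iota>" and inj: "inj \<iota>"
    and cpt: "\<And>S. bounded S \<Longrightarrow> compact (closure (\<iota> ` S))"
    using assms(2) unfolding compact_embedding_def compact_operator_def by auto
  interpret \<iota>: bounded_linear \<iota> by (fact bl)
  have \<iota>0: "\<iota> v = 0 \<longleftrightarrow> v = 0" for v using inj \<iota>.zero by (metis injD)

  note it = assms(14)[unfolded inverse_iteration_def]
  have w0: "w 0 = w0" and u0: "u (Suc n) \<noteq> 0" and Au: "A (u (Suc n)) v = B (w n) (\<iota> v)"
    and x: "x (Suc n) = inverse (norm (\<iota> (u (Suc n)))) *\<^sub>R u (Suc n)"
    and w: "w (Suc n) = \<iota> (x (Suc n))" and l: "l n = norm (\<iota> (u (Suc n))) powr (1 - p)" for n v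
    using it by auto
  have \<iota>u: "norm (\<iota> (u (Suc n))) > 0" for n using u0 by (simp add: \<iota>0)
  have \<iota>x: "norm (\<iota> (x (Suc n))) = 1" for n
    using \<iota>u[of n] by (simp add: x \<iota>.scaleR)
  have nw: "norm (w n) = 1" for n
    by (cases n) (simp_all add: w0 \<open>norm w0 = 1\<close> w \<iota>x)
  have lpos: "l n > 0" for n using \<iota>u[of n] by (simp add: l)
  \<comment> \<open>Normalizing \<open>u (Suc n)\<close> multiplies its image under \<open>A\<close>
    by the factor to the power \<open>p - 1\<close>, which is exactly \<open>l n\<close>.\<close>
  have Ax: "A (x (Suc n)) v = l n * B (w n) (\<iota> v)" for n v
  proof -
    have "inverse (norm (\<iota> (u (Suc n)))) powr (p - 1) = l n"
      using \<iota>u[of n] powr_minus[of "norm (\<iota> (u (Suc n)))" "p - 1"] by (simp add: l inverse_powr)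
    with \<iota>u[of n] show ?thesis by (simp add: x Ascale Au blinfun.scaleR_left)
  qed

  have xpos: "norm (x (Suc n)) > 0" for n using \<iota>x[of n] \<iota>.zero by auto
  have upper: "norm (x (Suc n)) powr p \<le> l n" for n
  proof -
    have "B (w n) (w (Suc n)) \<le> 1" using Ble[of "w n" "w (Suc n)"] by (simp add: nw)
    then show ?thesis
      using Ax[of n "x (Suc n)"] Aeq[of "x (Suc n)"] lpos[of n] by (simp add: powp flip: w)
  qed
  \<comment> \<open>The test vector must represent \<open>w (Suc n)\<close> in X, so the index
    starts at \<open>Suc n\<close>: \<open>x 0\<close> carries no meaning.\<close>
  have Axx: "A (x (Suc (Suc n))) (x (Suc n)) = l (Suc n)" for n
    using Ax[of "Suc n" "x (Suc n)"] Beq[of "w (Suc n)"] nw[of "Suc n"] by (simp flip: w)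
  have lower: "l (Suc n) \<le> norm (x (Suc (Suc n))) powr (p - 1) * norm (x (Suc n))" for n
    using Ale[of "x (Suc (Suc n))" "x (Suc n)"] by (simp add: Axx)
  \<comment> \<open>Chain \<open>upper\<close> and \<open>lower\<close> through
    \<open>l (Suc n)\<close> and cancel the positive common power.\<close>
  have xdec: "norm (x (Suc (Suc n))) \<le> norm (x (Suc n))" for n
  proof -
    have "norm (x (Suc (Suc n))) powr (p - 1) * norm (x (Suc (Suc n)))
        \<le> norm (x (Suc (Suc n))) powr (p - 1) * norm (x (Suc n))"
      using upper[of "Suc n"] lower[of n] unfolding powp by linarith
    then show ?thesis using xpos[of "Suc n"] by simp
  qed
  have between: "l (Suc n) \<le> norm (x (Suc n)) powr p" for n
  proof -
    have "norm (x (Suc (Suc n))) powr (p - 1) * norm (x (Suc n))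
        \<le> norm (x (Suc n)) powr (p - 1) * norm (x (Suc n))"
      using p xdec[of n] by (intro mult_right_mono powr_mono2) auto
    with lower[of n] show ?thesis unfolding powp by linarith
  qed
  have ldec: "decseq l"
    by (rule decseq_SucI) (rule order_trans[OF between upper])
  have xpdec: "decseq (\<lambda>n. norm (x (Suc n)) powr p)"
    by (rule decseq_SucI) (rule order_trans[OF upper between])

  \<comment> \<open>Continuity of \<iota> keeps vectors with Y-norm 1 away from 0 in X, which makes
    the limit \<open>a\<close> positive.\<close>
  obtain K where K: "K > 0" "\<And>v. norm (\<iota> v) \<le> norm v * K"
    using \<iota>.pos_bounded by blast
  have xK: "norm (x (Suc n)) \<ge> 1 / K" for n
    using K(2)[of "x (Suc n)"] K(1) by (simp add: \<iota>x field_simps)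
  have "decseq (\<lambda>n. norm (x (Suc n)))" by (rule decseq_SucI) (rule xdec)
  then obtain a where a: "(\<lambda>n. norm (x (Suc n))) \<longlonglongrightarrow> a"
    using decseq_convergent[of "\<lambda>n. norm (x (Suc n))" "1 / K"] xK by blast
  have "a \<ge> 1 / K" using a xK by (intro LIMSEQ_le_const[OF a]) auto
  with K(1) have apos: "a > 0" by (smt (verit) divide_pos_pos)
  define L where "L = a powr p"
  have Lpos: "L > 0" using apos by (simp add: L_def)
  have aL: "a powr (p - 1) * a = L"
    using powr_mult_base[of a "p - 1"] apos by (simp add: L_def mult.commute)
  have xpL: "(\<lambda>n. norm (x (Suc n)) powr p) \<longlonglongrightarrow> L"
    unfolding L_def using apos by (intro tendsto_powr a) auto
  have lSL: "(\<lambda>n. l (Suc n)) \<longlonglongrightarrow> L"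
    by (rule tendsto_sandwich[OF _ _ LIMSEQ_Suc[OF xpL] xpL])
      (use upper between in \<open>auto intro: always_eventually\<close>)
  then have lL: "l \<longlonglongrightarrow> L" by (simp only: filterlim_sequentially_Suc)
  have "L \<ge> \<mu>"
  proof (rule LIMSEQ_le_const[OF xpL], intro exI allI impI)
    fix n :: nat
    have "bdd_below {norm z powr p | z. norm (\<iota> z) = 1}"
      by (rule bdd_belowI[of _ 0]) auto
    then show "\<mu> \<le> norm (x (Suc n)) powr p"
      unfolding \<mu> using \<iota>x by (intro cInf_lower) auto
  qed

  have "bounded (range (\<lambda>n. x (Suc n)))"
    using \<open>decseq (\<lambda>n. norm (x (Suc n)))\<close> by (auto simp: bounded_iff decseq_def)
  from cpt[OF this] have "seq_compact (closure (range (\<lambda>n. w (Suc n))))"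
    by (simp add: compact_eq_seq_compact_metric image_image w)
  moreover have "\<forall>n. w (Suc n) \<in> closure (range (\<lambda>n. w (Suc n)))"
    using closure_subset by fast
  ultimately obtain y \<rho> where \<rho>: "strict_mono \<rho>" and "((\<lambda>n. w (Suc n)) \<circ> \<rho>) \<longlonglongrightarrow> y"
    by (rule seq_compactE)
  then have y: "(\<lambda>j. w (Suc (\<rho> j))) \<longlonglongrightarrow> y" by (simp add: o_def)
  have "norm y = 1"
    using LIMSEQ_unique[OF tendsto_norm[OF y]] nw by simp
  then have "y \<noteq> 0" by auto
  with AB obtain v where v: "\<And>z. A v z = B y (\<iota> z)" by blast
  \<comment> \<open>Scaling by \<open>t\<close> multiplies \<open>A v\<close> by
    \<open>t powr (p - 1) = L\<close>. Thus \<open>z\<close> is a candidate limit available before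
    any convergence in X is known.\<close>
  define t where "t = L powr (1 / (p - 1))"
  define z where "z = t *\<^sub>R v"
  have tp: "t > 0" "t powr (p - 1) = L"
    using Lpos p by (auto simp: t_def powr_powr)
  have Az: "A z h = L * B y (\<iota> h)" for h
    using tp by (simp add: z_def Ascale v blinfun.scaleR_left)
  define s where "s j = x (Suc (Suc (\<rho> j)))" for j
  have sub: "(\<lambda>j. f (\<rho> j)) \<longlonglongrightarrow> c" if "f \<longlonglongrightarrow> c" for f :: "nat \<Rightarrow> real" and c
    using LIMSEQ_subseq_LIMSEQ[OF that \<rho>] by (simp add: o_def)
  have sa: "(\<lambda>j. norm (s j)) \<longlonglongrightarrow> a" and xa: "(\<lambda>j. norm (x (Suc (\<rho> j)))) \<longlonglongrightarrow> a"
    and la: "(\<lambda>j. l (Suc (\<rho> j))) \<longlonglongrightarrow> L"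
    using sub[OF LIMSEQ_Suc[OF a]] sub[OF a] sub[OF lSL] by (simp_all add: s_def)
  have "(\<lambda>j. B (w (Suc (\<rho> j)))) \<longlonglongrightarrow> B y"
    using continuous_on_tendsto_compose[OF \<open>continuous_on UNIV B\<close> y] by simp
  \<comment> \<open>Composing with \<iota> as a bounded operator carries norm convergence from the
    dual of Y to the dual of X.\<close>
  then have "(\<lambda>j. l (Suc (\<rho> j)) *\<^sub>R (B (w (Suc (\<rho> j))) o\<^sub>L Blinfun \<iota>)) \<longlonglongrightarrow> L *\<^sub>R (B y o\<^sub>L Blinfun \<iota>)"
    by (intro tendsto_intros la)
  moreover have "l (Suc (\<rho> j)) *\<^sub>R (B (w (Suc (\<rho> j))) o\<^sub>L Blinfun \<iota>) = A (s j)" for j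
    by (rule blinfun_eqI) (simp add: s_def Ax blinfun.scaleR_left bounded_linear_Blinfun_apply[OF bl])
  moreover have "L *\<^sub>R (B y o\<^sub>L Blinfun \<iota>) = A z"
    by (rule blinfun_eqI) (simp add: Az blinfun.scaleR_left bounded_linear_Blinfun_apply[OF bl])
  ultimately have As: "(\<lambda>j. A (s j)) \<longlonglongrightarrow> A z" by simp

  have nA: "norm (A h) = norm h powr (p - 1)" for h
    using Ale Aeq A0 by (rule norm_duality_map)
  \<comment> \<open>Both sides are limits of the dual norms of \<open>A (s j)\<close>.\<close>
  have "norm z powr (p - 1) = a powr (p - 1)"
  proof (rule LIMSEQ_unique)
    show "(\<lambda>j. norm (s j) powr (p - 1)) \<longlonglongrightarrow> norm z powr (p - 1)"
      using tendsto_norm[OF As] by (simp only: nA)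
    show "(\<lambda>j. norm (s j) powr (p - 1)) \<longlonglongrightarrow> a powr (p - 1)"
      using apos by (intro tendsto_powr sa) auto
  qed
  then have nz: "norm z = a"
    using p apos powr_less_mono2[of "p - 1" "norm z" a] powr_less_mono2[of "p - 1" a "norm z"]
    by (cases "norm z" a rule: linorder_cases) auto
  have "(\<lambda>j. s j - z) \<longlonglongrightarrow> 0"
  proof (rule duality_map_tendsto[OF uc Ale Aeq sa _ apos])
    have "(\<lambda>j. A (s j) z) \<longlonglongrightarrow> A z z" by (intro tendsto_intros As)
    then show "(\<lambda>j. A (s j) z) \<longlonglongrightarrow> a powr (p - 1) * a" by (simp add: Aeq nz)
  qed (simp add: nz)
  then have sz: "s \<longlonglongrightarrow> z" by (rule LIM_zero_cancel)
  \<comment> \<open>By \<open>Axx\<close> the pairing of these consecutive iterates is exactly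
    \<open>l (Suc (\<rho> j))\<close>, whose limit \<open>L\<close> is the extremal value
    \<open>a powr (p - 1) * a\<close>.\<close>
  have "(\<lambda>j. s j - x (Suc (\<rho> j))) \<longlonglongrightarrow> 0"
    by (rule duality_map_tendsto[OF uc Ale Aeq sa xa apos]) (simp add: s_def Axx la aL)
  from tendsto_diff[OF sz this] have xz: "(\<lambda>j. x (Suc (\<rho> j))) \<longlonglongrightarrow> z" by simp
  have "y = \<iota> z"
    using LIMSEQ_unique[OF y] \<iota>.tendsto[OF xz] by (simp add: w)
  with \<open>norm y = 1\<close> have \<iota>z: "norm (\<iota> z) = 1" by simp
  \<comment> \<open>With \<open>y = \<iota> z\<close>, the equation \<open>Az\<close> is the
    eigenvalue equation, as the factor \<open>norm (\<iota> z) powr (p - q)\<close> equals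
    1.\<close>
  have ep: "eigenpair \<iota> p q A B L z"
    unfolding eigenpair_def using nz apos \<iota>z Az \<open>y = \<iota> z\<close> by auto
  have "strict_mono (\<lambda>j. Suc (\<rho> j))" using \<rho> by (simp add: strict_mono_def)
  then have "\<exists>r z. strict_mono r \<and> (\<forall>j. r j \<ge> 1) \<and> norm (\<iota> z) = 1 \<and>
          (\<lambda>j. x (r j)) \<longlonglongrightarrow> z \<and> (\<lambda>j. x (r j + 1)) \<longlonglongrightarrow> z \<and> eigenpair \<iota> p q A B L z"
    using \<iota>z xz sz ep by (intro exI[of _ "\<lambda>j. Suc (\<rho> j)"] exI[of _ z]) (simp add: s_def[abs_def])
  moreover have "w n = \<iota> (x n)" if "n \<ge> 1" for n using that by (cases n) (simp_all add: w)
  moreover have "eigenvalue \<iota> p q A B L" using ep unfolding eigenvalue_def by blast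
  ultimately show ?thesis
    using nw Ax ldec xpdec lL xpL \<open>L \<ge> \<mu>\<close> by blast
qed

end
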